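(* Suppose an even integer $n$ factors as $n=p_1^{\alpha_1}p_2^{\alpha_2}\cdots p_k^{\alpha_k}p_{k+1}$ with $k\ge 1$, $\alpha_i\ge 1$ for each $1\le i\le k$, and $p_1,\dots,p_{k+1}$ primes with $2=p_1<p_2<\cdots<p_k<p_{k+1}$. If these factors satisfy (1) $p_{i+1}=\tau(p_1^{\alpha_1}\cdots p_i^{\alpha_i})+1$ for each $1\le i<k$, (2) $p_{k+1}\le \tau(p_1^{\alpha_1}p_2^{\alpha_2}\cdots p_k^{\alpha_k})$, and (3) for each $1\le i\le k$, $p_{k+1}>\tau\left(\frac{n}{p_ip_{k+1}}\right)$, then $n$ is a primitive covering number.
   Context: $\tau(n)$ denotes the number of positive divisors of $n$. A covering system is a finite set of pairs $(a_i,m_i)$ such that every integer satisfies at least one of the congruences $x\equiv a_i \pmod{m_i}$. It is distinct if each modulus is used at most once. A positive integer $n$ is a covering number if there exists a distinct covering system in which every modulus is a divisor of $n$ that is greater than $1$. A covering number $n$ is a primitive covering number if it is not divisible by any smaller covering number. *)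

theory Defs
  imports Complex_Main "HOL-Number_Theory.Number_Theory"
begin

definition tau :: "nat \<Rightarrow> nat" where
  "tau n = card {d. d dvd n}"

text \<open>A pair \<open>(a, m)\<close> stands for the residue class of \<open>a\<close> modulo \<open>m\<close>; the representative
  \<open>a\<close> is an arbitrary integer and the modulus is a positive integer.\<close>

definition covering_system :: "(int \<times> nat) set \<Rightarrow> bool" where
  "covering_system S \<longleftrightarrow>
     finite S \<and> (\<forall>(a, m)\<in>S. m > 0) \<and> (\<forall>x::int. \<exists>(a, m)\<in>S. [x = a] (mod int m))"

definition distinct_covering_system :: "(int \<times> nat) set \<Rightarrow> bool" where
  "distinct_covering_system S \<longleftrightarrow> covering_system S \<and> inj_on snd S"

definition covering_number :: "nat \<Rightarrow> bool" where
  "covering_number n \<longleftrightarrow>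
     n > 0 \<and> (\<exists>S. distinct_covering_system S \<and> (\<forall>(a, m)\<in>S. m dvd n \<and> m > 1))"

definition primitive_covering_number :: "nat \<Rightarrow> bool" where
  "primitive_covering_number n \<longleftrightarrow>
     covering_number n \<and> (\<forall>d. d < n \<and> covering_number d \<longrightarrow> \<not> d dvd n)"

end

theory Submission
  imports Defs
begin

text \<open>
  Write \<open>M = p\<^sub>1\<^bsup>\<alpha>\<^sub>1\<^esup> \<cdots> p\<^sub>k\<^bsup>\<alpha>\<^sub>k\<^esup>\<close> and \<open>q = p\<^sub>k\<^sub>+\<^sub>1\<close>, so \<open>n = M q\<close>.
  Both halves of the theorem rest on one picture. Let \<open>p\<close> be a prime not dividing \<open>N\<close> and
  suppose that the moduli dividing \<open>N p\<^sup>j\<close> have been spent, leaving a class \<open>r\<close> modulo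
  \<open>N p\<^sup>j\<close> untouched. This class splits into \<open>p\<close> classes modulo \<open>N p\<^bsup>j+1\<^esup>\<close>, and
  the moduli that become available are the \<open>\<tau>(N)\<close> numbers \<open>d p\<^bsup>j+1\<^esup>\<close> with
  \<open>d\<close> dividing \<open>N\<close>. Each of them can be aimed at a subclass of choice
  (\<open>split_uncovered_class\<close>), and none of them meets two subclasses
  (\<open>uncovered_refine\<close>). So the largest number of subclasses that
  can be removed is \<open>min p (\<tau>(N))\<close>.

  If \<open>p = \<tau>(N) + 1\<close>, one subclass always survives, at every level \<open>j\<close>. Hypothesis (1) says
  that this happens for \<open>p\<^sub>2, \<dots>, p\<^sub>k\<close> in turn, and it holds for \<open>p\<^sub>1 = 2\<close> with
  \<open>N = 1\<close>. Hence the divisors of \<open>M\<close> can be used to cover everything but a single class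
  modulo \<open>M\<close>, and they can do no better: \<open>M\<close> is not a covering number. By (2) the last prime
  satisfies \<open>q \<le> \<tau>(M)\<close>, so the remaining class can be covered completely, and \<open>n\<close> is a
  covering number.

  Since multiples of covering numbers are covering numbers, primitivity only concerns the maximal
  proper divisors \<open>n / q = M\<close> and \<open>n / p\<^sub>i = N q\<close>, where \<open>N = M / p\<^sub>i\<close>. The first has
  been dealt with. For the second, \<open>N\<close> is not a covering number because it divides \<open>M\<close>, and by
  (3) \<open>q > \<tau>(N)\<close>, so passing from \<open>N\<close> to \<open>N q\<close> leaves some subclass uncovered.
\<close>

section \<open>Coverings as functions from moduli to residues\<close>

text \<open>In a distinct system the residue is a function of the modulus. Working with a total function
  \<open>c\<close> makes it possible to extend a system by overriding \<open>c\<close> on new moduli.\<close>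

definition covered :: "(nat \<Rightarrow> int) \<Rightarrow> nat \<Rightarrow> int \<Rightarrow> bool" where
  "covered c n x \<longleftrightarrow> (\<exists>m. m dvd n \<and> m > 1 \<and> [x = c m] (mod int m))"

lemma covering_number_iff:
  "covering_number n \<longleftrightarrow> n > 0 \<and> (\<exists>c. \<forall>x. covered c n x)"
proof
  assume n: "covering_number n"
  then obtain S where S: "covering_system S" "inj_on snd S" "\<forall>(a, m)\<in>S. m dvd n \<and> m > 1"
    unfolding covering_number_def distinct_covering_system_def by blast
  define c where "c m = (SOME a. (a, m) \<in> S)" for m
  have c: "c m = a" if "(a, m) \<in> S" for a m
  proof -
    have "(c m, m) \<in> S" unfolding c_def using that by (rule someI)
    with that S(2) show ?thesis by (metis inj_onD prod.inject snd_conv)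
  qed
  have "covered c n x" for x
  proof -
    have "\<exists>(a, m)\<in>S. [x = a] (mod int m)"
      using S(1) unfolding covering_system_def by blast
    then obtain a m where am: "(a, m) \<in> S" "[x = a] (mod int m)" by blast
    then have "m dvd n" "m > 1" using S(3) by blast+
    with am c[OF am(1)] show ?thesis unfolding covered_def by blast
  qed
  with n show "n > 0 \<and> (\<exists>c. \<forall>x. covered c n x)"
    unfolding covering_number_def by blast
next
  assume "n > 0 \<and> (\<exists>c. \<forall>x. covered c n x)"
  then obtain c where n: "n > 0" and c: "\<And>x. covered c n x" by blast
  define S where "S = (\<lambda>m. (c m, m)) ` {m. m dvd n \<and> m > 1}"
  have "finite S" unfolding S_def using n by simp
  moreover have "inj_on snd S" unfolding S_def by (auto simp: inj_on_def)
  moreover have "\<exists>(a, m)\<in>S. [x = a] (mod int m)" for x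
    using c[of x] unfolding covered_def S_def by auto
  moreover have "\<forall>(a, m)\<in>S. m dvd n \<and> m > 1" unfolding S_def by auto
  moreover have "\<forall>(a, m)\<in>S. m > 0" unfolding S_def by auto
  ultimately show "covering_number n"
    using n unfolding covering_number_def distinct_covering_system_def covering_system_def
    by blast
qed

lemma covered_mono: "covered c d x \<Longrightarrow> d dvd n \<Longrightarrow> covered c n x"
  unfolding covered_def by (meson dvd_trans)

lemma covering_number_mono:
  "covering_number d \<Longrightarrow> d dvd n \<Longrightarrow> n > 0 \<Longrightarrow> covering_number n"
  unfolding covering_number_iff by (meson covered_mono)

lemma not_covering_number_1: "\<not> covering_number 1"
  unfolding covering_number_iff covered_def by simp

section \<open>Passing to one more power of a prime\<close>

text \<open>The constructive step: \<open>s\<close> of the subclasses of \<open>r\<close> are removed, one for each of \<open>s\<close>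
  chosen divisors of \<open>N\<close>. A new modulus \<open>d p\<^bsup>j+1\<^esup>\<close> with the residue
  \<open>r + t N p\<^sup>j\<close> contains the whole subclass of that number because it divides
  \<open>N p\<^bsup>j+1\<^esup>\<close>.\<close>

lemma split_uncovered_class:
  fixes N p j s :: nat
  assumes N: "N > 0" and p: "prime p" "\<not> p dvd N" and s: "s \<le> tau N"
    and c: "\<And>x. covered c (N * p ^ j) x \<or> [x = r] (mod int (N * p ^ j))"
  shows "\<exists>c'. \<forall>x. covered c' (N * p ^ Suc j) x \<or>
           (\<exists>t\<in>{s..<p}. [x = r + int t * int (N * p ^ j)] (mod int (N * p ^ Suc j)))"
proof -
  define P where "P = N * p ^ j"
  have p1: "p > 1" using p(1) by (rule prime_gt_1_nat)
  have PS: "N * p ^ Suc j = P * p" by (simp add: P_def)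
  have P0: "P > 0" using N p1 by (simp add: P_def)
  have "card {..<s} \<le> card {d. d dvd N}" using s by (simp add: tau_def)
  then obtain g where g: "g ` {..<s} \<subseteq> {d. d dvd N}" "inj_on g {..<s}"
    using card_le_inj[of "{..<s}" "{d. d dvd N}"] finite_divisors_nat[OF N] by blast
  define h where "h t = g t * p ^ Suc j" for t
  have h_inj: "inj_on h {..<s}"
    using g(2) p1 by (auto simp: inj_on_def h_def)
  have h_dvd: "h t dvd P * p" if "t < s" for t
    using g(1) that unfolding h_def PS[symmetric] by (auto intro: mult_dvd_mono)
  have h_new: "\<not> h t dvd P" for t
  proof
    assume "h t dvd P"
    then have "p ^ j * p dvd p ^ j * N"
      by (metis P_def dvd_mult_right h_def mult.commute power_Suc)
    with p1 p(2) show False by simp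
  qed
  have h_gt1: "h t > 1" if "t < s" for t
  proof -
    have "h t \<noteq> 0" using h_dvd[OF that] P0 p1 by (metis dvd_0_left mult_eq_0_iff not_gr0 not_one_less_zero)
    moreover have "h t \<noteq> 1" using h_new[of t] by auto
    ultimately show ?thesis by simp
  qed
  define c' where
    "c' m = (if m \<in> h ` {..<s} then r + int (the_inv_into {..<s} h m) * int P else c m)" for m
  have c'_new: "c' (h t) = r + int t * int P" if "t < s" for t
    using that h_inj by (simp add: c'_def the_inv_into_f_f)
  have c'_old: "c' m = c m" if "m dvd P" for m
    using that h_new by (auto simp: c'_def)
  have "covered c' (P * p) x \<or> (\<exists>t\<in>{s..<p}. [x = r + int t * int P] (mod int (P * p)))" for x
  proof (cases "covered c P x")
    case True
    then have "covered c' P x" unfolding covered_def using c'_old by metis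
    then show ?thesis using covered_mono by (metis dvd_triv_left)
  next
    case False
    then have "[x = r] (mod int P)" using c P_def by blast
    then obtain u where u: "x = r + int P * u"
      by (metis cong_iff_lin cong_sym)
    define t where "t = nat (u mod int p)"
    have t: "t < p" "int t = u mod int p"
      using p1 by (simp_all add: t_def nat_less_iff)
    obtain w where "u = int t + int p * w"
      using t(2) by (metis mod_mult_div_eq)
    then have "x = r + int t * int P + int (P * p) * w"
      using u by (simp add: algebra_simps)
    then have x_cong: "[x = r + int t * int P] (mod int (P * p))"
      by (metis cong_iff_lin cong_sym)
    show ?thesis
    proof (cases "t < s")
      case True
      have "int (h t) dvd int (P * p)" using h_dvd[OF True] by (simp only: of_nat_dvd_iff)
      then have "[x = c' (h t)] (mod int (h t))"
        using cong_dvd_modulus[OF x_cong] c'_new[OF True] by simp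
      then show ?thesis using h_dvd h_gt1 True unfolding covered_def by blast
    next
      case False
      with t(1) x_cong show ?thesis by auto
    qed
  qed
  then show ?thesis unfolding PS P_def[symmetric] by blast
qed

text \<open>The obstruction: since \<open>p\<close> does not divide \<open>N\<close>, two numbers that differ by a multiple of
  \<open>N p\<^sup>j\<close> and agree modulo \<open>p\<^bsup>j+1\<^esup>\<close> lie in the same subclass. So every new modulus
  meets at most one subclass of \<open>x\<close>, and with more than \<open>\<tau>(N)\<close> subclasses one stays free.\<close>

lemma uncovered_refine:
  fixes N p j :: nat
  assumes N: "N > 0" and p: "prime p" "\<not> p dvd N" "p > tau N"
    and x: "\<not> covered c (N * p ^ j) x"
  shows "\<exists>y. \<not> covered c (N * p ^ Suc j) y"
proof (rule ccontr)
  assume "\<not> ?thesis"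
  then have all: "covered c (N * p ^ Suc j) y" for y by blast
  define P where "P = N * p ^ j"
  have p1: "p > 1" using p(1) by (rule prime_gt_1_nat)
  define D where "D = (\<lambda>d. d * p ^ Suc j) ` {d. d dvd N}"
  have "\<exists>m\<in>D. [x + int t * int P = c m] (mod int m)" for t
  proof -
    obtain m where m: "m dvd N * p ^ Suc j" "m > 1" "[x + int t * int P = c m] (mod int m)"
      using all unfolding covered_def by blast
    \<comment> \<open>A modulus dividing \<open>P\<close> does not tell \<open>x\<close> from \<open>x + t P\<close>, and \<open>x\<close> is uncovered.\<close>
    have new: "\<not> m dvd P"
    proof
      assume mP: "m dvd P"
      then have "[x + int t * int P = x] (mod int m)"
        by (simp add: cong_iff_dvd_diff)
      then have "[x = c m] (mod int m)" using m(3) cong_sym cong_trans by blast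
      with x mP m(2) show False unfolding covered_def P_def by blast
    qed
    obtain d e where de: "m = d * e" "d dvd N" "e dvd p ^ Suc j"
      using division_decomp[OF m(1)] by blast
    then obtain i where i: "i \<le> Suc j" "e = p ^ i"
      using divides_primepow_nat[OF p(1)] by blast
    have "i = Suc j"
    proof (rule ccontr)
      assume "i \<noteq> Suc j"
      with i(1) have "p ^ i dvd p ^ j" by (simp add: le_imp_power_dvd)
      with de(2) new show False by (simp add: de(1) i(2) P_def mult_dvd_mono)
    qed
    with de i m(3) show ?thesis unfolding D_def by blast
  qed
  then obtain f where f: "f t \<in> D" "[x + int t * int P = c (f t)] (mod int (f t))" for t
    by metis
  have "card D \<le> tau N"
    unfolding D_def tau_def using finite_divisors_nat[OF N] by (rule card_image_le)
  moreover have "finite D" unfolding D_def using finite_divisors_nat[OF N] by simp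
  then have "card (f ` {..<p}) \<le> card D" using f(1) by (intro card_mono) auto
  ultimately have "\<not> inj_on f {..<p}" using p(3) card_image[of f "{..<p}"] by auto
  then obtain s t where st: "s < p" "t < p" "s \<noteq> t" "f s = f t"
    unfolding inj_on_def by auto
  have "p ^ Suc j dvd f t" using f(1)[of t] unfolding D_def by auto
  then have "[x + int s * int P = x + int t * int P] (mod int (p ^ Suc j))"
    using f(2)[of s] f(2)[of t] st(4) by (metis cong_dvd_modulus cong_sym cong_trans of_nat_dvd_iff)
  then have "[s * P = t * P] (mod p ^ Suc j)"
    by (simp add: cong_add_lcancel flip: cong_int_iff)
  then have "[p ^ j * (s * N) = p ^ j * (t * N)] (mod p ^ j * p)"
    unfolding P_def by (simp add: ac_simps)
  then have "[s * N = t * N] (mod p)"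
    using p1 by (simp add: cong_def mult_mod_right[symmetric])
  moreover have "coprime N p"
    using prime_imp_coprime[OF p(1,2)] by (simp add: coprime_commute)
  ultimately have "[s = t] (mod p)" by (simp add: cong_mult_rcancel_nat)
  with st show False by (simp add: cong_def)
qed

section \<open>Adjoining a full prime power\<close>

text \<open>The new moduli at each level are as many as the divisors of \<open>N\<close>, whatever the level. So
  the \<open>p - 1\<close> divisors of \<open>N\<close> remove all subclasses but one at each of the \<open>a\<close> levels.\<close>

lemma cover_all_but_one_class:
  fixes N p a :: nat
  assumes "N > 0" "prime p" "\<not> p dvd N" "p = tau N + 1"
    and "\<exists>c r. \<forall>x. covered c N x \<or> [x = r] (mod int N)"
  shows "\<exists>c r. \<forall>x. covered c (N * p ^ a) x \<or> [x = r] (mod int (N * p ^ a))"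
proof (induction a)
  case 0
  then show ?case using assms(5) by simp
next
  case (Suc a)
  then obtain c r where "\<And>x. covered c (N * p ^ a) x \<or> [x = r] (mod int (N * p ^ a))" by blast
  from split_uncovered_class[OF assms(1-3) _ this, of "tau N"] obtain c' where
    "\<forall>x. covered c' (N * p ^ Suc a) x \<or>
       (\<exists>t\<in>{tau N..<p}. [x = r + int t * int (N * p ^ a)] (mod int (N * p ^ Suc a)))"
    by blast
  moreover have "{tau N..<p} = {tau N}" using assms(4) by auto
  ultimately show ?case by auto
qed

text \<open>The system \<open>c\<close> is fixed before the induction on \<open>a\<close>: for each single \<open>c\<close>, an
  integer left uncovered at one level yields one left uncovered at the next.\<close>

lemma not_covering_number_mult_prime_power:
  fixes N p a :: nat
  assumes "N > 0" "prime p" "\<not> p dvd N" "p > tau N" and N: "\<not> covering_number N"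
  shows "\<not> covering_number (N * p ^ a)"
proof -
  have "\<exists>x. \<not> covered c (N * p ^ a) x" for c
  proof (induction a)
    case 0
    then show ?case using N assms(1) by (auto simp: covering_number_iff)
  next
    case (Suc a)
    then show ?case using uncovered_refine[OF assms(1-4)] by blast
  qed
  then show ?thesis unfolding covering_number_iff by blast
qed

section \<open>Covering and primitivity\<close>

theorem theorem2p5:
  fixes n k :: nat and p \<alpha> :: "nat \<Rightarrow> nat"
  assumes "even n"
    and "n = (\<Prod>i=1..k. p i ^ \<alpha> i) * p (k + 1)"
    and "k \<ge> 1"
    and "\<And>i. 1 \<le> i \<Longrightarrow> i \<le> k \<Longrightarrow> \<alpha> i \<ge> 1"
    and "\<And>i. 1 \<le> i \<Longrightarrow> i \<le> k + 1 \<Longrightarrow> prime (p i)"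
    and "p 1 = 2"
    and "\<And>i. 1 \<le> i \<Longrightarrow> i \<le> k \<Longrightarrow> p i < p (i + 1)"
    and "\<And>i. 1 \<le> i \<Longrightarrow> i < k \<Longrightarrow> p (i + 1) = tau (\<Prod>j=1..i. p j ^ \<alpha> j) + 1"
    and "p (k + 1) \<le> tau (\<Prod>j=1..k. p j ^ \<alpha> j)"
    and "\<And>i. 1 \<le> i \<Longrightarrow> i \<le> k \<Longrightarrow> p (k + 1) > tau (n div (p i * p (k + 1)))"
  shows "primitive_covering_number n"
proof -
  define M where "M i = (\<Prod>j=1..i. p j ^ \<alpha> j)" for i
  define q where "q = p (k + 1)"
  have M_Suc: "M (Suc i) = M i * p (Suc i) ^ \<alpha> (Suc i)" for i
    by (simp add: M_def)
  have n: "n = M k * q" using assms(2) by (simp add: M_def q_def)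
  have q: "prime q" using assms(5)[of "k + 1"] by (simp add: q_def)
  have M_pos: "M i > 0" if "i \<le> k" for i
    using that assms(5) unfolding M_def by (intro prod_pos) (auto simp: prime_gt_0_nat)
  have n_pos: "n > 0" using n M_pos[of k] q by (simp add: prime_gt_0_nat)
  have p_less: "p i < p j" if "1 \<le> i" "i < j" "j \<le> k + 1" for i j
    using that(2,3)
  proof (induction j)
    case (Suc j)
    then show ?case using assms(7)[of j] that(1) by (cases "i = j") auto
  qed simp
  have prime_dvd_M: "\<exists>j\<in>{1..i}. r = p j" if "prime r" "r dvd M i" "i \<le> k" for r i
  proof -
    have "\<exists>j\<in>{1..i}. r dvd p j ^ \<alpha> j"
      using that(1,2) prime_dvd_prod_iff[of "{1..i}" r "\<lambda>j. p j ^ \<alpha> j"]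
      unfolding M_def by blast
    then obtain j where j: "j \<in> {1..i}" "r dvd p j ^ \<alpha> j" by blast
    then have "prime (p j)" using assms(5)[of j] that(3) by simp
    moreover have "r dvd p j" using that(1) j(2) by (rule prime_dvd_power)
    ultimately have "r = p j" using that(1) by (simp add: primes_dvd_imp_eq)
    with j(1) show ?thesis by blast
  qed
  have not_dvd_M: "\<not> p (Suc i) dvd M i" if i: "i \<le> k" for i
  proof
    assume "p (Suc i) dvd M i"
    then obtain j where "j \<in> {1..i}" "p (Suc i) = p j"
      using prime_dvd_M[of "p (Suc i)" i] assms(5)[of "Suc i"] i by auto
    with p_less[of j "Suc i"] i show False by auto
  qed
  \<comment> \<open>The empty product gives \<open>p 1 = tau 1 + 1\<close>, so the prime 2 is treated like the others.\<close>
  have step: "p (Suc i) = tau (M i) + 1" if "i < k" for i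
  proof (cases "i = 0")
    case True
    then show ?thesis using assms(6) by (simp add: M_def tau_def)
  next
    case False
    then show ?thesis using assms(8)[of i] that by (simp add: M_def)
  qed
  have all_but_one: "\<exists>c r. \<forall>x. covered c (M i) x \<or> [x = r] (mod int (M i))" if "i \<le> k" for i
    using that
  proof (induction i)
    case 0
    then show ?case by (simp add: M_def)
  next
    case (Suc i)
    then have "i < k" "prime (p (Suc i))" using assms(5)[of "Suc i"] by simp_all
    with Suc show ?case unfolding M_Suc
      using M_pos[of i] not_dvd_M[of i] step[of i] by (intro cover_all_but_one_class) simp_all
  qed
  have M_not: "\<not> covering_number (M i)" if "i \<le> k" for i
    using that
  proof (induction i)
    case 0
    then show ?case using not_covering_number_1 by (simp add: M_def)
  next
    case (Suc i)
    then have "i < k" "prime (p (Suc i))" using assms(5)[of "Suc i"] by simp_all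
    with Suc show ?case unfolding M_Suc
      using M_pos[of i] not_dvd_M[of i] step[of i]
      by (intro not_covering_number_mult_prime_power) simp_all
  qed
  have q_not_dvd: "\<not> q dvd M k" using not_dvd_M[of k] by (simp add: q_def)

  have "covering_number n"
  proof -
    obtain c r where "\<And>x. covered c (M k) x \<or> [x = r] (mod int (M k))"
      using all_but_one[of k] by blast
    then have cr: "\<And>x. covered c (M k * q ^ 0) x \<or> [x = r] (mod int (M k * q ^ 0))" by simp
    have "q \<le> tau (M k)" using assms(9) by (simp add: M_def q_def)
    \<comment> \<open>Taking all \<open>q\<close> subclasses leaves the empty index range \<open>{q..<q}\<close>.\<close>
    from split_uncovered_class[OF M_pos q q_not_dvd this cr]
    show ?thesis using n n_pos by (simp add: covering_number_iff)
  qed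
  \<comment> \<open>A proper divisor of \<open>n\<close> divides \<open>n div r\<close> for some prime \<open>r\<close>, so it suffices to treat those.\<close>
  moreover have "\<not> d dvd n" if d: "d < n" "covering_number d" for d
  proof
    assume "d dvd n"
    then obtain e where e: "n = d * e" by blast
    with d(1) have "e \<noteq> 1" by auto
    then obtain r where r: "prime r" "r dvd e" using prime_factor_nat by blast
    then obtain e' where "e = r * e'" by blast
    with e have n_r: "n = r * (d * e')" by simp
    have "covering_number (d * e')"
      using covering_number_mono[OF d(2), of "d * e'"] n_r n_pos by simp
    then have cov: "covering_number (n div r)"
      using n_r r(1) by (simp add: prime_gt_0_nat)
    have "r dvd M k * q" using n n_r by (metis dvd_triv_left)
    then consider "r = q" | "r dvd M k"
      using r(1) q by (metis prime_dvd_mult_iff primes_dvd_imp_eq)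
    then show False
    proof cases
      case 1
      then have "n div r = M k" using n q by (simp add: prime_gt_0_nat)
      with cov M_not[of k] show False by simp
    next
      case 2
      then obtain i where i: "i \<in> {1..k}" "r = p i" using prime_dvd_M[OF r(1), of k] by auto
      obtain N where N: "M k = r * N" using 2 by blast
      have "n div r = N * q ^ 1" "n div (r * q) = N"
        using n N r(1) q by (simp_all add: prime_gt_0_nat mult.assoc)
      moreover have N_pos: "N > 0" using N M_pos[of k] by auto
      moreover have "\<not> covering_number N"
        using covering_number_mono[of N "M k"] M_not[of k] M_pos[of k] N by auto
      moreover have "\<not> q dvd N" using q_not_dvd N by auto
      moreover have "q > tau (n div (r * q))" using assms(10)[of i] i by (simp add: q_def)
      ultimately show False
        using not_covering_number_mult_prime_power[of N q 1] q cov by simp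
    qed
  qed
  ultimately show ?thesis unfolding primitive_covering_number_def by blast
qed

end
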